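(* For $N\ge2$ let $A_N$ be the (unweighted) "path with double fork" graph on $N+4$ nodes, consisting of a path graph on $N$ nodes with two additional nodes attached to one end of the path and another two additional nodes attached to the other end. Then the spectral degree exponent $q$ of $A_N$ does not depend on $N$, and $q\approx 2.36864$ (correct to the five printed decimals, i.e. $|q-2.36864|<5\cdot10^{-6}$).
   Context: In $A_N$, each of the four additional nodes is adjacent only to the end node of the path to which it is attached. Spectral degree exponent (SDE): for a finite simple undirected non-regular graph with $n$ nodes, degrees $d_1,\dots,d_n$ and spectral radius $\lambda_1$ (the largest eigenvalue of the adjacency matrix), the SDE is the solution $q$ of $$\lambda_1=\left(\frac1n\sum_{i=1}^n d_i^{\,q}\right)^{1/q}.$$ It is a known fact that this solution exists, is unique and lies in $[2,\infty]$, where for $q=\infty$ the right-hand side is understood as its limit, the maximum degree. *)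

theory Defs
  imports
    "HOL-Library.Extended_Real"
    "Graph_Theory.Pair_Digraph"
    "Jordan_Normal_Form.Spectral_Radius"
begin

text \<open>
  Finite simple undirected graphs are the structures satisfying \<^const>\<open>pair_graph\<close>, in which an
  edge is a pair of opposite arcs; the degree of a vertex is its out-degree. To have adjacency
  matrices available, the vertices of a graph with \<open>n\<close> nodes are taken to be \<open>0, \<dots>, n - 1\<close>.
\<close>

definition degree_of :: "nat pair_pre_digraph \<Rightarrow> nat \<Rightarrow> nat" where
  "degree_of G v = out_degree (with_proj G) v"

definition regular_graph :: "nat pair_pre_digraph \<Rightarrow> bool" where
  "regular_graph G \<longleftrightarrow> (\<exists>k. \<forall>v \<in> pverts G. degree_of G v = k)"

definition adjacency_matrix :: "nat pair_pre_digraph \<Rightarrow> real mat" where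
  "adjacency_matrix G =
     mat (card (pverts G)) (card (pverts G)) (\<lambda>(i, j). if (i, j) \<in> parcs G then 1 else 0)"

text \<open>
  The library's \<^const>\<open>spectral_radius\<close> is the maximal modulus of an eigenvalue of a complex matrix.
  Here we take the largest eigenvalue; the adjacency matrix is symmetric, so that all its
  eigenvalues are real.
\<close>

definition largest_eigenvalue :: "nat pair_pre_digraph \<Rightarrow> real" where
  "largest_eigenvalue G = Max (spectrum (adjacency_matrix G))"

definition degree_power_mean :: "nat pair_pre_digraph \<Rightarrow> real \<Rightarrow> real" where
  "degree_power_mean G q =
     ((\<Sum>v \<in> pverts G. real (degree_of G v) powr q) / real (card (pverts G))) powr (1 / q)"

text \<open>
  The equation \<open>\<lambda>\<^sub>1 = M\<^sub>q(d)\<close>, for every \<open>q\<close> for which it makes sense: the exponent \<open>1/q\<close> excludes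
  \<open>q = 0\<close>, and a power of a degree with negative exponent is meaningful only if no degree vanishes
  (whereas \<^term>\<open>(0::real) powr q = 0\<close>). For \<open>q = \<infinity>\<close> the right-hand side is the limit of the power means.
\<close>

fun SDE_equation :: "nat pair_pre_digraph \<Rightarrow> ereal \<Rightarrow> bool" where
  "SDE_equation G (ereal q) \<longleftrightarrow>
     q \<noteq> 0 \<and> (q < 0 \<longrightarrow> (\<forall>v \<in> pverts G. 0 < degree_of G v)) \<and>
     largest_eigenvalue G = degree_power_mean G q"
| "SDE_equation G PInfty \<longleftrightarrow> largest_eigenvalue G = real (Max (degree_of G ` pverts G))"
| "SDE_equation G MInfty \<longleftrightarrow> False"

text \<open>
  The spectral degree exponent as a relation: \<open>q\<close> is the one and only solution of the equation.
\<close>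

definition is_SDE :: "nat pair_pre_digraph \<Rightarrow> ereal \<Rightarrow> bool" where
  "is_SDE G q \<longleftrightarrow>
     pair_graph G \<and> pverts G = {..<card (pverts G)} \<and> \<not> regular_graph G \<and>
     SDE_equation G q \<and> (\<forall>p. SDE_equation G p \<longrightarrow> p = q)"

text \<open>
  The path is \<open>0, \<dots>, N - 1\<close>; the nodes \<open>N\<close>, \<open>N + 1\<close> are attached to its end \<open>0\<close> and
  the nodes \<open>N + 2\<close>, \<open>N + 3\<close> to its end \<open>N - 1\<close>.
\<close>

definition double_fork_edges :: "nat \<Rightarrow> nat rel" where
  "double_fork_edges N =
     {(i, i + 1) | i. i + 1 < N} \<union>
     {(0, N), (0, N + 1), (N - 1, N + 2), (N - 1, N + 3)}"

definition double_fork :: "nat \<Rightarrow> nat pair_pre_digraph" where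
  "double_fork N =
     \<lparr> pverts = {..<N + 4}, parcs = double_fork_edges N \<union> (double_fork_edges N)\<inverse> \<rparr>"

end

theory Submission
  imports Defs "HOL-Analysis.Harmonic_Numbers"
begin

text \<open>
  The vector with entry 2 on the path and 1 on the four leaves is a positive eigenvector for the
  eigenvalue 2, so the largest eigenvalue of every double fork is 2. Degree counting turns
  the SDE equation into \<open>4 + 2 \<cdot> 3\<^sup>q + (N - 2) 2\<^sup>q = (N + 4) 2\<^sup>q\<close>, in which \<open>N\<close> cancels:
  \<open>(3/2)\<^sup>q + 2 (1/2)\<^sup>q = 3\<close>. The left-hand side is strictly convex and \<open>q = 0\<close> is one solution, so
  there is at most one other, which is located by a sign change.
\<close>

unbundle no vec_syntax

section \<open>Largest eigenvalue from a positive eigenvector\<close>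

text \<open>Collatz-Wielandt bound by a maximum principle: scale \<open>w\<close> until it just
  dominates the moduli of an eigenvector and read the eigenvalue equation in a row where the two
  touch.\<close>

lemma eigenvalue_le_positive_subeigenvector:
  fixes A :: "real mat" and w :: "nat \<Rightarrow> real"
  assumes A: "A \<in> carrier_mat n n"
    and nonneg: "\<And>i j. i < n \<Longrightarrow> j < n \<Longrightarrow> 0 \<le> A $$ (i, j)"
    and pos: "\<And>i. i < n \<Longrightarrow> 0 < w i"
    and sub: "\<And>i. i < n \<Longrightarrow> (\<Sum>j<n. A $$ (i, j) * w j) \<le> r * w i"
    and ev: "eigenvalue A k"
  shows "k \<le> r"
proof -
  obtain v where v: "v \<in> carrier_vec n" "v \<noteq> 0\<^sub>v n" "A *\<^sub>v v = k \<cdot>\<^sub>v v"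
    using ev A unfolding eigenvalue_def eigenvector_def by auto
  obtain i0 where i0: "i0 < n" "v $ i0 \<noteq> 0"
    using v(1,2) by (metis eq_vecI carrier_vecD index_zero_vec(1,2))
  \<comment> \<open>The least factor with \<open>\<bar>v $ j\<bar> \<le> c * w j\<close> for all
    \<open>j\<close>; equality at a maximizing index \<open>i\<close> is what lets row
    \<open>i\<close> bound \<open>k\<close>.\<close>
  define c where "c = Max ((\<lambda>i. \<bar>v $ i\<bar> / w i) ` {..<n})"
  have le_c: "\<bar>v $ i\<bar> / w i \<le> c" if "i < n" for i
    unfolding c_def using that by (intro Max_ge) auto
  have "c \<in> (\<lambda>i. \<bar>v $ i\<bar> / w i) ` {..<n}"
    unfolding c_def using i0 by (intro Max_in) auto
  then obtain i where i: "i < n" "c = \<bar>v $ i\<bar> / w i" by auto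
  have "0 < \<bar>v $ i0\<bar> / w i0" using i0 pos by simp
  hence "c > 0" using le_c[OF i0(1)] by linarith
  have vi: "\<bar>v $ i\<bar> = c * w i" using i(2) pos[OF i(1)] by (simp add: less_imp_neq[symmetric])
  have vj: "\<bar>v $ j\<bar> \<le> c * w j" if "j < n" for j
    using le_c[OF that] pos[OF that] by (simp add: pos_divide_le_eq)
  have "k * v $ i = (A *\<^sub>v v) $ i" using v i by simp
  also have "\<dots> = (\<Sum>j<n. A $$ (i, j) * v $ j)"
    using A v(1) i(1) by (auto simp: scalar_prod_def atLeast0LessThan)
  finally have "k * v $ i = (\<Sum>j<n. A $$ (i, j) * v $ j)" .
  hence "\<bar>k\<bar> * (c * w i) = \<bar>\<Sum>j<n. A $$ (i, j) * v $ j\<bar>"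
    by (metis abs_mult vi)
  also have "\<dots> \<le> (\<Sum>j<n. \<bar>A $$ (i, j) * v $ j\<bar>)" by (rule sum_abs)
  also have "\<dots> \<le> (\<Sum>j<n. A $$ (i, j) * (c * w j))"
    using nonneg i(1) vj by (intro sum_mono) (auto simp: abs_mult intro!: mult_left_mono)
  also have "\<dots> = c * (\<Sum>j<n. A $$ (i, j) * w j)"
    by (simp add: sum_distrib_left mult_ac)
  also have "\<dots> \<le> c * (r * w i)"
    using sub[OF i(1)] \<open>c > 0\<close> by simp
  finally have "\<bar>k\<bar> * (c * w i) \<le> r * (c * w i)" by (simp add: mult_ac)
  moreover have "0 < c * w i" using \<open>c > 0\<close> pos[OF i(1)] by (rule mult_pos_pos)
  ultimately have "\<bar>k\<bar> \<le> r" by (simp only: mult_le_cancel_right_pos)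
  thus ?thesis by linarith
qed

text \<open>The preceding bound caps the spectrum at \<open>r\<close>, and \<open>w\<close> itself
  witnesses that \<open>r\<close> is attained.\<close>

lemma Max_spectrum_positive_eigenvector:
  fixes A :: "real mat" and w :: "nat \<Rightarrow> real"
  assumes A: "A \<in> carrier_mat n n" and "0 < n"
    and nonneg: "\<And>i j. i < n \<Longrightarrow> j < n \<Longrightarrow> 0 \<le> A $$ (i, j)"
    and pos: "\<And>i. i < n \<Longrightarrow> 0 < w i"
    and eq: "\<And>i. i < n \<Longrightarrow> (\<Sum>j<n. A $$ (i, j) * w j) = r * w i"
  shows "Max (spectrum A) = r"
proof (rule Max_eqI)
  show "finite (spectrum A)" using card_finite_spectrum[OF A] by simp
  show "k \<le> r" if "k \<in> spectrum A" for k
    using eigenvalue_le_positive_subeigenvector[OF A nonneg pos, where r = r and k = k] eq that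
    by (auto simp: spectrum_def)
  have "A *\<^sub>v Matrix.vec n w = r \<cdot>\<^sub>v Matrix.vec n w"
    using A eq by (intro eq_vecI) (auto simp: scalar_prod_def atLeast0LessThan)
  moreover have "Matrix.vec n w \<noteq> 0\<^sub>v n"
    using pos[OF \<open>0 < n\<close>] \<open>0 < n\<close> by (metis index_vec index_zero_vec(1) less_irrefl)
  ultimately have "eigenvector A (Matrix.vec n w) r"
    using A by (simp add: eigenvector_def)
  thus "r \<in> spectrum A"
    by (auto simp: spectrum_def eigenvalue_def)
qed

section \<open>Double forks\<close>

lemma double_fork_simps [simp]:
  "pverts (double_fork N) = {..<N + 4}"
  "parcs (double_fork N) = double_fork_edges N \<union> (double_fork_edges N)\<inverse>"
  by (simp_all add: double_fork_def)

text \<open>Source of both the degrees and the rows of the adjacency matrix. It includes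
  \<open>N = 2\<close>, where the ends \<open>0\<close> and \<open>1\<close> are each other's path
  neighbour.\<close>

lemma double_fork_neighbours:
  assumes "2 \<le> N" "i < N + 4"
  shows "{j. (i, j) \<in> parcs (double_fork N)} =
    (if i = 0 then {1, N, N + 1} else if i = N - 1 then {N - 2, N + 2, N + 3}
     else if i < N then {i - 1, i + 1} else if i < N + 2 then {0} else {N - 1})"
  using assms by (auto simp: double_fork_edges_def split: if_splits)

lemma double_fork_edge_less: "2 \<le> N \<Longrightarrow> (i, j) \<in> double_fork_edges N \<Longrightarrow> i < j \<and> j < N + 4"
  by (auto simp: double_fork_edges_def)

lemma double_fork_pair_graph:
  assumes "2 \<le> N"
  shows "pair_graph (double_fork N)"
proof -
  note less = double_fork_edge_less[OF assms]
  have "parcs (double_fork N) \<subseteq> {..<N + 4} \<times> {..<N + 4}"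
    using less by fastforce
  hence "finite (parcs (double_fork N))"
    by (rule finite_subset) simp
  moreover have "symmetric (with_proj (double_fork N))"
    by (auto simp: symmetric_def arcs_ends_def arc_to_ends_def sym_def)
  ultimately show ?thesis
    by unfold_locales (use less in fastforce)+
qed

lemma degree_of_conv_neighbours: "degree_of G i = card {j. (i, j) \<in> parcs G}"
proof -
  have "out_arcs (with_proj G) i = Pair i ` {j. (i, j) \<in> parcs G}"
    by (auto simp: out_arcs_def)
  thus ?thesis
    by (simp add: degree_of_def out_degree_def card_image inj_on_def)
qed

lemma degree_of_double_fork:
  assumes "2 \<le> N" "i < N + 4"
  shows "degree_of (double_fork N) i = (if i = 0 \<or> i = N - 1 then 3 else if i < N then 2 else 1)"
proof -
  \<comment> \<open>Removes truncated subtraction, so that the listed neighbours are seen to be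
    distinct.\<close>
  obtain M where "N = 2 + M" using assms(1) le_Suc_ex by blast
  thus ?thesis
    unfolding degree_of_conv_neighbours double_fork_neighbours[OF assms] by auto
qed

lemma double_fork_not_regular:
  assumes "2 \<le> N"
  shows "\<not> regular_graph (double_fork N)"
proof
  assume "regular_graph (double_fork N)"
  hence "degree_of (double_fork N) 0 = degree_of (double_fork N) N"
    unfolding regular_graph_def by auto
  thus False using assms by (simp add: degree_of_double_fork split: if_splits)
qed

lemma Max_degree_double_fork:
  assumes "2 \<le> N"
  shows "Max (degree_of (double_fork N) ` pverts (double_fork N)) = 3"
proof (rule Max_eqI)
  have "degree_of (double_fork N) 0 = 3" using assms by (simp add: degree_of_double_fork)
  thus "3 \<in> degree_of (double_fork N) ` pverts (double_fork N)" by force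
qed (use assms in \<open>auto simp: degree_of_double_fork\<close>)

text \<open>The graph is the affine Dynkin diagram of type D with \<open>N + 4\<close> nodes, and
  \<open>w\<close> below is its vector of marks.\<close>

lemma largest_eigenvalue_double_fork:
  assumes "2 \<le> N"
  shows "largest_eigenvalue (double_fork N) = 2"
proof -
  obtain M where M: "N = 2 + M" using assms le_Suc_ex by blast
  define w :: "nat \<Rightarrow> real" where "w i = (if i < N then 2 else 1)" for i
  let ?A = "adjacency_matrix (double_fork N)"
  have "(\<Sum>j<N + 4. ?A $$ (i, j) * w j) = 2 * w i" if i: "i < N + 4" for i
  proof -
    let ?S = "{j. (i, j) \<in> parcs (double_fork N)}"
    have "?S \<subseteq> {..<N + 4}" using double_fork_edge_less[OF assms] by fastforce
    have "(\<Sum>j<N + 4. ?A $$ (i, j) * w j) = (\<Sum>j<N + 4. if j \<in> ?S then w j else 0)"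
      using i by (intro sum.cong) (auto simp: adjacency_matrix_def)
    also have "\<dots> = sum w ?S"
      using \<open>?S \<subseteq> {..<N + 4}\<close> by (simp add: sum.If_cases Int_absorb1 del: double_fork_simps)
    \<comment> \<open>Leaf: 2 = 2 * 1; inner path node: 2 + 2 = 2 * 2; path end: 2 + 1 + 1 = 2 *
      2.\<close>
    also have "\<dots> = 2 * w i"
      unfolding double_fork_neighbours[OF assms i] using i by (auto simp: w_def M)
    finally show ?thesis .
  qed
  thus ?thesis
    unfolding largest_eigenvalue_def
    by (intro Max_spectrum_positive_eigenvector[where n = "N + 4" and w = w])
      (auto simp: adjacency_matrix_def w_def)
qed

lemma sum_degree_powr_double_fork:
  assumes "2 \<le> N"
  shows "(\<Sum>v \<in> pverts (double_fork N). real (degree_of (double_fork N) v) powr q) =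
    4 + 2 * 3 powr q + (real N - 2) * 2 powr q"
proof -
  obtain M where N: "N = Suc (Suc M)"
    using assms by (metis Suc_le_D numeral_2_eq_2 Suc_le_mono)
  \<comment> \<open>Lets the last five terms be split off: the path end \<open>N - 1\<close> and the
    four leaves. The end \<open>0\<close> is split off by the index shift, leaving the
    \<open>M\<close> inner nodes.\<close>
  hence N4: "N + 4 = Suc (Suc (Suc (Suc (Suc (Suc M)))))" by simp
  define d where "d i = (if i = 0 \<or> i = N - 1 then 3 else if i < N then 2 else 1 :: real)" for i
  have "(\<Sum>v<N + 4. real (degree_of (double_fork N) v) powr q) = (\<Sum>v<N + 4. d v powr q)"
    using assms by (intro sum.cong) (auto simp: degree_of_double_fork d_def)
  also have "\<dots> = (\<Sum>v<Suc M. d v powr q) + 3 powr q + 4"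
    unfolding N4 by (simp add: N d_def)
  also have "(\<Sum>v<Suc M. d v powr q) = 3 powr q + (\<Sum>v<M. d (Suc v) powr q)"
    by (subst sum.lessThan_Suc_shift) (simp add: d_def)
  also have "(\<Sum>v<M. d (Suc v) powr q) = (\<Sum>v<M. 2 powr q)"
    by (intro sum.cong) (auto simp: d_def N)
  finally show ?thesis by (simp add: N)
qed

section \<open>The equation for the exponent\<close>

text \<open>Defined at \<open>0\<close> too: this spurious zero is what limits the number of genuine
  solutions to one.\<close>

definition fork_fun :: "real \<Rightarrow> real" where
  "fork_fun q = (3/2) powr q + 2 * (1/2) powr q - 3"

lemma fork_fun_0 [simp]: "fork_fun 0 = 0"
  by (simp add: fork_fun_def)

lemma degree_power_mean_double_fork_eq_2_iff:
  assumes "2 \<le> N" "q \<noteq> 0"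
  shows "degree_power_mean (double_fork N) q = 2 \<longleftrightarrow> fork_fun q = 0"
proof -
  define S where "S = (4 + 2 * 3 powr q + (real N - 2) * 2 powr q) / (real N + 4)"
  have "S > 0" unfolding S_def using assms
    by (intro divide_pos_pos add_pos_nonneg) auto
  have "degree_power_mean (double_fork N) q = S powr (1 / q)"
    unfolding degree_power_mean_def sum_degree_powr_double_fork[OF assms(1)] by (simp add: S_def)
  also have "\<dots> = 2 \<longleftrightarrow> S = 2 powr q"
  proof
    assume "S powr (1 / q) = 2"
    hence "(S powr (1 / q)) powr q = 2 powr q" by simp
    thus "S = 2 powr q" using assms(2) \<open>S > 0\<close> by (simp add: powr_powr)
  qed (use assms(2) in \<open>simp add: powr_powr\<close>)
  \<comment> \<open>Here \<open>N\<close> disappears: after clearing the denominator,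
    \<open>N * 2 powr q\<close> occurs on both sides. Dividing by \<open>2 * 2 powr q\<close> then
    yields \<open>fork_fun\<close>.\<close>
  also have "\<dots> \<longleftrightarrow> 4 + 2 * 3 powr q = 6 * 2 powr q"
    unfolding S_def by (auto simp: field_simps)
  also have "\<dots> \<longleftrightarrow> fork_fun q = 0"
    unfolding fork_fun_def by (auto simp: powr_divide field_simps)
  finally show ?thesis .
qed

text \<open>Infinity fails because the maximum degree 3 differs from 2. All degrees are positive, so
  negative exponents are admissible and must be excluded through the zeros of
  \<open>fork_fun\<close>.\<close>

lemma SDE_equation_double_fork_iff:
  assumes "2 \<le> N"
  shows "SDE_equation (double_fork N) p \<longleftrightarrow> (\<exists>q. p = ereal q \<and> q \<noteq> 0 \<and> fork_fun q = 0)"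
proof (cases p)
  case (real q)
  have "\<forall>v \<in> pverts (double_fork N). 0 < degree_of (double_fork N) v"
    using assms by (simp add: degree_of_double_fork)
  thus ?thesis
    using real degree_power_mean_double_fork_eq_2_iff[OF assms, of q]
    by (auto simp: largest_eigenvalue_double_fork[OF assms] simp del: double_fork_simps)
next
  case PInf
  have "\<not> SDE_equation (double_fork N) PInfty"
    unfolding SDE_equation.simps largest_eigenvalue_double_fork[OF assms]
      Max_degree_double_fork[OF assms] by simp
  thus ?thesis using PInf by simp
next
  case MInf
  have "\<not> SDE_equation (double_fork N) MInfty" by (simp only: SDE_equation.simps not_False_eq_True)
  thus ?thesis using MInf by simp
qed

lemma fork_fun_deriv:
  "(fork_fun has_real_derivative (3/2) powr x * ln (3/2) - 2 * (1/2) powr x * ln 2) (at x)"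
  unfolding fork_fun_def
  by (auto intro!: derivative_eq_intros simp: ln_div)

text \<open>Strict convexity of \<open>fork_fun\<close>: the power with base above 1 grows, and the
  subtracted one with base below 1 shrinks.\<close>

lemma fork_fun_deriv_strict_mono:
  fixes x y :: real
  assumes "x < y"
  shows "(3/2) powr x * ln (3/2) - 2 * (1/2) powr x * ln 2
    < (3/2) powr y * ln (3/2) - 2 * (1/2) powr y * ln (2::real)"
proof -
  have "(3/2) powr x < (3/2::real) powr y"
    using assms by (intro powr_less_mono) auto
  moreover have "(1/2) powr y < (1/2::real) powr x"
    using assms by (simp add: powr_divide frac_less2)
  moreover have "0 < ln (3/2::real)" "0 < ln (2::real)" by simp_all
  ultimately have "(3/2) powr x * ln (3/2) < (3/2) powr y * ln (3/2::real)"
    and "(1/2) powr y * ln 2 < (1/2) powr x * ln (2::real)"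
    by (simp_all del: ln_gt_zero_iff)
  thus ?thesis by linarith
qed

text \<open>Rolle on both intervals gives zeros of the derivative on either side of
  \<open>b\<close>, against its strict monotonicity.\<close>

lemma fork_fun_no_three_zeros:
  assumes "a < b" "b < c" "fork_fun a = 0" "fork_fun b = 0" "fork_fun c = 0"
  shows False
proof -
  let ?D = "\<lambda>x::real. (3/2) powr x * ln (3/2) - 2 * (1/2) powr x * ln (2::real)"
  have "\<exists>z. l < z \<and> z < u \<and> ?D z = 0" if "l < u" "fork_fun l = 0" "fork_fun u = 0" for l u
    using MVT2[OF \<open>l < u\<close>, of fork_fun ?D] fork_fun_deriv that by auto
  from this[of a b] this[of b c] assms obtain x y
    where "x < b" "?D x = 0" "b < y" "?D y = 0" by blast
  thus False using fork_fun_deriv_strict_mono[of x y] by simp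
qed

text \<open>Otherwise \<open>0\<close>, \<open>p\<close>, \<open>q\<close> are three zeros; the six
  instances cover their possible orders.\<close>

lemma fork_fun_nonzero_zero_unique:
  assumes "fork_fun p = 0" "fork_fun q = 0" "p \<noteq> 0" "q \<noteq> 0"
  shows "p = q"
  using fork_fun_no_three_zeros[of 0 p q] fork_fun_no_three_zeros[of 0 q p]
    fork_fun_no_three_zeros[of p 0 q] fork_fun_no_three_zeros[of q 0 p]
    fork_fun_no_three_zeros[of p q 0] fork_fun_no_three_zeros[of q p 0] assms
  by (metis fork_fun_0 linorder_neqE_linordered_idom)

section \<open>Numerical bounds\<close>

lemma exp_Taylor_error:
  fixes x :: real
  assumes "\<bar>x\<bar> \<le> 1"
  shows "\<bar>exp x - (\<Sum>m<n. x ^ m / fact m)\<bar> \<le> 3 * \<bar>x\<bar> ^ n / fact n"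
proof -
  obtain t where t: "\<bar>t\<bar> \<le> \<bar>x\<bar>" "exp x = (\<Sum>m<n. x ^ m / fact m) + exp t / fact n * x ^ n"
    using Maclaurin_exp_le by blast
  have "exp t \<le> exp 1" using t assms by simp
  hence "exp t \<le> 3" using exp_le by linarith
  have "\<bar>exp x - (\<Sum>m<n. x ^ m / fact m)\<bar> = exp t * \<bar>x\<bar> ^ n / fact n"
    unfolding t(2) by (simp add: abs_mult power_abs)
  also have "\<dots> \<le> 3 * \<bar>x\<bar> ^ n / fact n"
    using \<open>exp t \<le> 3\<close> by (intro divide_right_mono mult_right_mono) auto
  finally show ?thesis .
qed

text \<open>Here 13440 = 8!/3, from the Lagrange remainder with \<open>exp t \<le> 3\<close>. The
  free \<open>u\<close> and \<open>l\<close> make each use a purely rational check.\<close>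

lemma exp_Taylor_bounds:
  fixes x :: real
  assumes "\<bar>x\<bar> \<le> 1"
  defines "p \<equiv> 1 + x + x^2/2 + x^3/6 + x^4/24 + x^5/120 + x^6/720 + x^7/5040"
  shows exp_le_Taylor: "p + x^8 / 13440 \<le> u \<Longrightarrow> exp x \<le> u"
    and exp_ge_Taylor: "l \<le> p - x^8 / 13440 \<Longrightarrow> l \<le> exp x"
proof -
  have p: "(\<Sum>m<8. x ^ m / fact m) = p"
    by (simp add: p_def fact_numeral lessThan_nat_numeral lessThan_Suc)
  have "\<bar>exp x - p\<bar> \<le> x^8 / 13440"
    using exp_Taylor_error[OF assms(1), of 8] unfolding p by (simp add: fact_numeral)
  thus "p + x^8 / 13440 \<le> u \<Longrightarrow> exp x \<le> u" "l \<le> p - x^8 / 13440 \<Longrightarrow> l \<le> exp x"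
    by linarith+
qed

lemma ln_2_bounds: "6931471 / 10^7 \<le> ln (2::real)" "ln (2::real) \<le> 6931472 / 10^7"
  \<comment> \<open>The truncation order 7, like 5 for \<open>ln (3/2)\<close>, is enough for seven
    decimals.\<close>
  using ln_approx_bounds[of 2 7] by (simp_all add: eval_nat_numeral)

lemma ln_3_halves_bounds:
  "4054651 / 10^7 \<le> ln (3/2::real)" "ln (3/2::real) \<le> 4054652 / 10^7"
  using ln_approx_bounds[of "3/2" 5] by (simp_all add: eval_nat_numeral)

text \<open>Splitting off the exponent 2 exactly leaves small arguments of \<open>exp\<close> for
  \<open>e\<close> near 0.37, where the Taylor bounds apply and are sharp.\<close>

lemma fork_fun_shift:
  "fork_fun (2 + e) = 9/4 * exp (e * ln (3/2)) + 1/2 * exp (- (e * ln 2)) - 3"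
proof -
  have "(3/2) powr e = exp (e * ln (3/2))" "(1/2) powr e = exp (- (e * ln 2))"
    by (simp_all add: powr_def ln_div)
  thus ?thesis by (simp add: fork_fun_def powr_add power2_eq_square)
qed

text \<open>The point is 2.36864 - 5/10^6. The value is only about -4/10^6, hence the many
  digits.\<close>

lemma fork_fun_neg: "fork_fun (2368635 / 10^6) < 0"
proof -
  \<comment> \<open>Both exponents are rounded up to rationals; in \<open>fork_fun_pos\<close> they
    are rounded down.\<close>
  have "exp (368635/10^6 * ln (3/2)) \<le> exp (1494687/10^7 :: real)"
    "exp (- (368635/10^6 * ln 2)) \<le> exp (- (2555182/10^7) :: real)"
    using ln_3_halves_bounds ln_2_bounds by simp_all
  moreover have "exp (1494687/10^7 :: real) \<le> 116121713/100000000" "exp (- (2555182/10^7) :: real) \<le> 77451506/100000000"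
    by (rule exp_le_Taylor; simp add: power_divide)+
  ultimately have "fork_fun (2 + 368635/10^6) < 0" unfolding fork_fun_shift by linarith
  thus ?thesis by simp
qed

lemma fork_fun_pos: "0 < fork_fun (2368645 / 10^6)"
proof -
  have "exp (1494726/10^7 :: real) \<le> exp (368645/10^6 * ln (3/2))"
    "exp (- (2555254/10^7) :: real) \<le> exp (- (368645/10^6 * ln 2))"
    using ln_3_halves_bounds ln_2_bounds by simp_all
  moreover have "116122164/100000000 \<le> exp (1494726/10^7 :: real)" "77450944/100000000 \<le> exp (- (2555254/10^7) :: real)"
    by (rule exp_ge_Taylor; simp add: power_divide)+
  ultimately have "0 < fork_fun (2 + 368645/10^6)" unfolding fork_fun_shift by linarith
  thus ?thesis by simp
qed

lemma fork_fun_zero_exists: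
  obtains q where "2368635 / 10^6 < q" "q < 2368645 / 10^6" "fork_fun q = 0"
proof -
  have "\<exists>q\<ge>2368635 / 10^6. q \<le> 2368645 / 10^6 \<and> fork_fun q = 0"
    using fork_fun_neg fork_fun_pos DERIV_isCont[OF fork_fun_deriv]
    by (intro IVT) auto
  \<comment> \<open>The endpoints are not zeros, so the bounds are strict.\<close>
  thus ?thesis using that fork_fun_neg fork_fun_pos
    by (metis less_irrefl order_le_imp_less_or_eq)
qed

theorem theorem7:
  shows "\<exists>q::real. (\<forall>N\<ge>2. is_SDE (double_fork N) (ereal q)) \<and>
           \<bar>q - 2.36864\<bar> < 5 / 10 ^ 6"
proof -
  \<comment> \<open>Chosen before \<open>N\<close>, since \<open>fork_fun\<close> does not involve
    \<open>N\<close>.\<close>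
  obtain q where q: "2368635 / 10^6 < q" "q < 2368645 / 10^6" "fork_fun q = 0"
    by (rule fork_fun_zero_exists)
  have "q \<noteq> 0" using q by auto
  have "is_SDE (double_fork N) (ereal q)" if "2 \<le> N" for N
    unfolding is_SDE_def SDE_equation_double_fork_iff[OF that]
    using double_fork_pair_graph[OF that] double_fork_not_regular[OF that] q(3) \<open>q \<noteq> 0\<close>
    by (auto dest: fork_fun_nonzero_zero_unique simp del: double_fork_simps(2))
  moreover have "\<bar>q - 2.36864\<bar> < 5 / 10 ^ 6"
    unfolding abs_diff_less_iff using q by simp
  ultimately show ?thesis by blast
qed

end
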